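(* Let $\gamma_k$ be the uplink zero-forcing SINR of terminal $k$ in cell $l$ under delayed channels (defined in the context). For fixed transmit power $p_r$ and fixed number of terminals $K$, $$\gamma_k\to\frac1C\quad\text{almost surely as }N\to\infty.$$
   Context: Parameters: integers $L\ge 2$ (cells), $K\ge 1$ (terminals per cell), $N\ge K$ (base-station antennas), $\tau\ge K$ (pilot length); a cell index $l\in\{1,\dots,L\}$ and a terminal index $k\in\{1,\dots,K\}$; reals $p_r>0$, $\beta_{lij}>0$ ($1\le i\le L$, $1\le j\le K$), and a temporal correlation parameter $\alpha$ with $0<|\alpha|\le 1$; all of these except $N$ are fixed. Put $p_{\mathrm{tr}}=\tau p_r$, $\hat\beta_{lij}=\beta_{lij}^2/\big(\sum_{i'=1}^L\beta_{li'j}+1/p_{\mathrm{tr}}\big)$ and $C=\sum_{i\neq l}(\beta_{lik}/\beta_{llk})^2$. Channel model (for each $N$, all on a common probability space): $\mathcal{CN}(0,\Sigma)$ denotes the circularly symmetric complex Gaussian law. $\hat G_{ll}$ is an $N\times K$ complex random matrix with independent columns, the $j$th column having law $\mathcal{CN}(0,\hat\beta_{llj}I_N)$. For $i\ne l$, $\hat G_{li}=\hat G_{ll}D_i$ with $D_i=\mathrm{diag}(\beta_{li1}/\beta_{ll1},\dots,\beta_{liK}/\beta_{llK})$. For $i=1,\dots,L$, $\tilde E_{li}$ is an $N\times K$ complex random matrix with independent columns, the $j$th column having law $\mathcal{CN}(0,(\beta_{lij}-\alpha^2\hat\beta_{lij})I_N)$. The family $(\tilde E_{l1},\dots,\tilde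 E_{lL})$ is independent of $\hat G_{ll}$. SINR: with $\hat G_{ll}^\dagger=(\hat G_{ll}^H\hat G_{ll})^{-1}\hat G_{ll}^H$ (almost surely defined), $[A]_k$ the $k$th row of $A$ and $\|\cdot\|$ the Euclidean norm, $$\gamma_k=\frac{\alpha^2p_r}{\alpha^2p_r\sum_{i\ne l}\|[\hat G_{ll}^\dagger]_k\hat G_{li}\|^2+p_r\sum_{i=1}^L\|[\hat G_{ll}^\dagger]_k\tilde E_{li}\|^2+\|[\hat G_{ll}^\dagger]_k\|^2}.$$ *)

theory Defs
  imports "HOL-Probability.Probability" "Jordan_Normal_Form.Schur_Decomposition"
begin

(* Cells, terminals and antennas are numbered from 0: {..<L}, {..<K}, {..<N}.
   In \<beta> l i j, l is the receiving cell, i the transmitting cell, j the terminal. *)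

(* Law of CN(0, S) for Hermitian positive definite S, as a measure on {..<n} \<rightarrow>\<^sub>E UNIV:
   density exp (- z^H S^{-1} z) / (\<pi>^n det S) with respect to Lebesgue measure on C^n.
   The quadratic form and the determinant are real for such S; Re only adjusts the type.
   Degenerate S is not covered; all covariances used below are positive multiples of 1. *)
definition complex_gaussian :: "complex mat \<Rightarrow> (nat \<Rightarrow> complex) measure" where
  "complex_gaussian S =
     (let n = dim_row S in
      density (\<Pi>\<^sub>M a\<in>{..<n}. lborel)
        (\<lambda>z. ennreal (exp (- Re ((the (mat_inverse S) *\<^sub>v vec n z) \<bullet>c vec n z))
                      / (pi ^ n * Re (det S)))))"

definition gaussian_columns ::
    "'a measure \<Rightarrow> nat \<Rightarrow> nat \<Rightarrow> (nat \<Rightarrow> real) \<Rightarrow> ('a \<Rightarrow> complex mat) \<Rightarrow> bool" where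
  "gaussian_columns M N K v X \<longleftrightarrow>
     (\<forall>\<omega>\<in>space M. X \<omega> \<in> carrier_mat N K) \<and>
     prob_space.indep_vars M (\<lambda>j. \<Pi>\<^sub>M a\<in>{..<N}. borel) (\<lambda>j \<omega>. \<lambda>a\<in>{..<N}. X \<omega> $$ (a, j)) {..<K} \<and>
     (\<forall>j<K. distr M (\<Pi>\<^sub>M a\<in>{..<N}. borel) (\<lambda>\<omega>. \<lambda>a\<in>{..<N}. X \<omega> $$ (a, j))
              = complex_gaussian (complex_of_real (v j) \<cdot>\<^sub>m 1\<^sub>m N))"

definition beta_hat :: "(nat \<Rightarrow> nat \<Rightarrow> nat \<Rightarrow> real) \<Rightarrow> nat \<Rightarrow> real \<Rightarrow> nat \<Rightarrow> nat \<Rightarrow> nat \<Rightarrow> real" where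
  "beta_hat \<beta> L p_tr l i j = (\<beta> l i j)\<^sup>2 / ((\<Sum>i'<L. \<beta> l i' j) + 1 / p_tr)"

(* Unspecified value where A^H A is singular. *)
definition zf_pinv :: "complex mat \<Rightarrow> complex mat" where
  "zf_pinv A = the (mat_inverse (mat_adjoint A * A)) * mat_adjoint A"

definition vec_norm2 :: "complex vec \<Rightarrow> real" where
  "vec_norm2 v = L2_set (\<lambda>i. cmod (v $ i)) {..<dim_vec v}"

(* The row vector g A is written as the column vector A^T g (no conjugation). *)
definition zf_sinr ::
    "real \<Rightarrow> real \<Rightarrow> nat \<Rightarrow> nat \<Rightarrow> nat \<Rightarrow> (nat \<Rightarrow> complex mat) \<Rightarrow> (nat \<Rightarrow> complex mat) \<Rightarrow> real" where
  "zf_sinr \<alpha> p L l k G E =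
     (let g = row (zf_pinv (G l)) k in
      \<alpha>\<^sup>2 * p /
      (\<alpha>\<^sup>2 * p * (\<Sum>i\<in>{..<L} - {l}. (vec_norm2 (transpose_mat (G i) *\<^sub>v g))\<^sup>2)
       + p * (\<Sum>i<L. (vec_norm2 (transpose_mat (E i) *\<^sub>v g))\<^sup>2)
       + (vec_norm2 g)\<^sup>2))"

end

(* Zero forcing inverts the training interference exactly: the row g of the pseudo-inverse satisfies
   g G = e_k, so each pilot-contaminating cell contributes (\<beta>_lik / \<beta>_llk)^2, and it remains to show
   that |g|^2 and |g E_i|^2 vanish. Both follow from bounds on h = row k of (G^H G)^{-1}, because
   |g|^2 = cnj h_k and g E_i = h G^H E_i: it suffices that almost surely, for large N, the diagonal
   entries of G^H G / N stay above v_j / 2 while its off-diagonal entries and those of G^H E_i / N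
   tend to 0. The matrices for different N are unrelated, so the law of large numbers is not
   available; instead Chernoff bounds give failure probabilities q^N with q < 1, and Borel-Cantelli
   applies. *)
theory Submission
  imports Defs
begin

section \<open>Exponential moments of complex Gaussian vectors\<close>

text \<open>The inner product of two independent Gaussian vectors is only subexponential: its
  exponential moment is finite near 0 and has the closed form
  \<open>(1 / (1 - w * v * t^2 / 4)) ^ n\<close>. A Chernoff bound with small parameter therefore
  suffices, since the threshold gains linearly in \<open>t\<close> while the moment costs
  quadratically. For the diagonal, each antenna contributes mean \<open>v_j\<close> to the squared
  norm, so any fixed fraction of \<open>v_j\<close> below 1 would be exceeded for large N; one half
  permits an explicit Chernoff parameter. The inverse Gram matrix is never computed. Row k solves h
  (G^H G) = e_k, and diagonal dominance bounds its entries by a multiple of 1/N. Hence |g|^2 is of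
  order 1/N, while each entry of g E_i is a sum of K averages with bounded coefficients, each
  average tending to 0. Since K is fixed, only finitely many null sets and eventual bounds have to
  be combined. The limit may be taken in the quotient because C is positive: with L \<ge> 2 there is
  at least one interfering cell.\<close>

text \<open>Completing the square turns the integrand into a constant multiple of the normal density
  with mean \<open>r / (2 * c)\<close> and variance \<open>1 / (2 * c)\<close>, whose total mass is
  1.\<close>

lemma nn_integral_exp_quadratic:
  fixes c r :: real
  assumes "c > 0"
  shows "(\<integral>\<^sup>+x. ennreal (exp (r * x - c * x\<^sup>2)) \<partial>lborel) = ennreal (sqrt (pi / c) * exp (r\<^sup>2 / (4 * c)))"
proof -
  define \<mu> where "\<mu> = r / (2 * c)"
  define \<sigma> where "\<sigma> = 1 / sqrt (2 * c)"
  have \<sigma>: "\<sigma> > 0" "\<sigma>\<^sup>2 = 1 / (2 * c)"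
    using assms by (simp_all add: \<sigma>_def power_divide)
  have "(\<integral>\<^sup>+x. ennreal (normal_density \<mu> \<sigma> x) \<partial>lborel) = 1"
    using prob_space.emeasure_space_1[OF prob_space_normal_density[OF \<sigma>(1), of \<mu>]]
    by (simp add: emeasure_density)
  moreover have "exp (r * x - c * x\<^sup>2) = sqrt (pi / c) * exp (r\<^sup>2 / (4 * c)) * normal_density \<mu> \<sigma> x" for x
  proof -
    have e1: "r * x - c * x\<^sup>2 = r\<^sup>2 / (4 * c) + - (x - \<mu>)\<^sup>2 / (2 * \<sigma>\<^sup>2)"
    proof -
      have "- (x - \<mu>)\<^sup>2 / (2 * \<sigma>\<^sup>2) = - (c * (x - \<mu>)\<^sup>2)"
        using assms by (simp add: \<sigma>(2))
      also have "\<dots> = r * x - c * x\<^sup>2 - r\<^sup>2 / (4 * c)"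
        using assms by (simp add: \<mu>_def power2_eq_square field_simps)
      finally show ?thesis by simp
    qed
    have e2: "sqrt (pi / c) * (1 / sqrt (2 * pi * \<sigma>\<^sup>2)) = 1"
      using assms by (simp add: \<sigma> real_sqrt_divide real_sqrt_mult)
    have "sqrt (pi / c) * exp (r\<^sup>2 / (4 * c)) * normal_density \<mu> \<sigma> x
        = (sqrt (pi / c) * (1 / sqrt (2 * pi * \<sigma>\<^sup>2))) * (exp (r\<^sup>2 / (4 * c)) * exp (- (x - \<mu>)\<^sup>2 / (2 * \<sigma>\<^sup>2)))"
      unfolding normal_density_def by (simp only: mult_ac)
    also have "\<dots> = exp (r * x - c * x\<^sup>2)"
      by (simp only: e1 e2 exp_add mult_1)
    finally show ?thesis by simp
  qed
  ultimately show ?thesis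
    using assms by (simp only: ennreal_mult'' normal_density_nonneg) (subst nn_integral_cmult; simp)
qed

text \<open>\<open>Re (cnj b * z)\<close> is the real inner product of \<open>b\<close> and
  \<open>z\<close> in the plane, so the integrand splits over the basis 1, \<open>\<i>\<close> into
  two real integrals of the previous kind.\<close>

lemma nn_integral_exp_quadratic_complex:
  fixes b :: complex and c :: real
  assumes "c > 0"
  shows "(\<integral>\<^sup>+z. ennreal (exp (Re (cnj b * z) - c * (cmod z)\<^sup>2)) \<partial>lborel)
           = ennreal (pi / c * exp ((cmod b)\<^sup>2 / (4 * c)))"
proof -
  have eq: "exp (Re (cnj b * z) - c * (cmod z)\<^sup>2)
      = (\<Prod>u\<in>Basis. exp ((b \<bullet> u) * (z \<bullet> u) - c * (z \<bullet> u)\<^sup>2))" for z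
    by (simp add: Basis_complex_def complex_inner_i_right cmod_power2 exp_add[symmetric] algebra_simps)
  have "(\<integral>\<^sup>+z. ennreal (exp (Re (cnj b * z) - c * (cmod z)\<^sup>2)) \<partial>lborel)
      = (\<integral>\<^sup>+z. (\<Prod>u\<in>Basis. ennreal (exp ((b \<bullet> u) * (z \<bullet> u) - c * (z \<bullet> u)\<^sup>2))) \<partial>(lborel :: complex measure))"
    by (subst eq) (simp add: prod_ennreal)
  also have "\<dots> = (\<Prod>u\<in>(Basis::complex set). \<integral>\<^sup>+x. ennreal (exp ((b \<bullet> u) * x - c * x\<^sup>2)) \<partial>lborel)"
    by (rule nn_integral_lborel_prod) auto
  also have "\<dots> = (\<Prod>u\<in>(Basis::complex set). ennreal (sqrt (pi / c) * exp ((b \<bullet> u)\<^sup>2 / (4 * c))))"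
    using assms by (simp add: nn_integral_exp_quadratic)
  also have "\<dots> = ennreal (sqrt (pi / c) * sqrt (pi / c) * (exp ((Re b)\<^sup>2 / (4 * c)) * exp ((Im b)\<^sup>2 / (4 * c))))"
  proof -
    define q where "q = sqrt (pi / c)"
    have "q \<ge> 0" using assms by (simp add: q_def)
    then show ?thesis
      by (simp add: Basis_complex_def complex_inner_i_right ennreal_mult[symmetric] mult_ac flip: q_def)
  qed
  also have "\<dots> = ennreal (pi / c * exp ((cmod b)\<^sup>2 / (4 * c)))"
  proof -
    have "sqrt (pi / c) * sqrt (pi / c) = pi / c"
      using assms by (intro real_sqrt_mult_self[THEN trans]) simp
    then show ?thesis
      by (simp only: exp_add[symmetric] cmod_power2 add_divide_distrib)
  qed
  finally show ?thesis .
qed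

text \<open>A one-sided inverse of a square matrix over a field is two-sided, so the elimination
  behind \<open>mat_inverse\<close> cannot fail, and inverses are unique. This evaluates
  \<open>mat_inverse\<close> without unfolding the elimination.\<close>

lemma mat_inverse_eqI:
  fixes A B :: "'a :: field mat"
  assumes A: "A \<in> carrier_mat n n" and B: "B \<in> carrier_mat n n" and BA: "B * A = 1\<^sub>m n"
  shows "mat_inverse A = Some B"
proof -
  have AB: "A * B = 1\<^sub>m n"
    using mat_mult_left_right_inverse[OF B A BA] .
  then have "A \<in> Units (ring_mat TYPE('a) n ())"
    using A B BA unfolding Units_def by (auto simp: ring_mat_def)
  then obtain B' where B': "mat_inverse A = Some B'"
    using mat_inverse(1)[OF A, of "()"] by (cases "mat_inverse A") auto
  from mat_inverse(2)[OF A this] have "A * B' = 1\<^sub>m n" "B' \<in> carrier_mat n n"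
    by auto
  then have "B' = B"
    using A B BA assoc_mult_mat[of B n n A n B' n] by simp
  with B' show ?thesis by simp
qed

text \<open>For a scalar covariance the quadratic form is a sum over coordinates and the determinant
  is \<open>v ^ n\<close>, so the density factors: the coordinates are independent with law CN(0,
  v).\<close>

lemma complex_gaussian_scalar:
  assumes "v > 0"
  shows "complex_gaussian (complex_of_real v \<cdot>\<^sub>m 1\<^sub>m n)
    = density (\<Pi>\<^sub>M a\<in>{..<n}. lborel) (\<lambda>z. \<Prod>a<n. ennreal (exp (- (cmod (z a))\<^sup>2 / v) / (pi * v)))"
proof -
  have inv: "mat_inverse (complex_of_real v \<cdot>\<^sub>m 1\<^sub>m n) = Some (complex_of_real (1 / v) \<cdot>\<^sub>m 1\<^sub>m n)"
    using assms by (intro mat_inverse_eqI[where n=n]) (auto intro!: eq_matI)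
  have form: "Re (((complex_of_real (1 / v) \<cdot>\<^sub>m 1\<^sub>m n) *\<^sub>v vec n z) \<bullet>c vec n z) = (\<Sum>a<n. (cmod (z a))\<^sup>2 / v)" for z
  proof -
    have "(complex_of_real (1 / v) \<cdot>\<^sub>m 1\<^sub>m n) *\<^sub>v vec n z = complex_of_real (1 / v) \<cdot>\<^sub>v vec n z"
      by (intro eq_vecI) auto
    then show ?thesis
      by (simp add: scalar_prod_def conjugate_complex_def cmod_power2 lessThan_atLeast0 add_divide_distrib
          flip: power2_eq_square)
  qed
  have "ennreal (exp (- (\<Sum>a<n. (cmod (z a))\<^sup>2 / v)) / (pi ^ n * Re (complex_of_real v ^ n)))
     = (\<Prod>a<n. ennreal (exp (- (cmod (z a))\<^sup>2 / v) / (pi * v)))" for z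
  proof -
    have "exp (- (\<Sum>a<n. (cmod (z a))\<^sup>2 / v)) = (\<Prod>a<n. exp (- (cmod (z a))\<^sup>2 / v))"
      by (subst exp_sum[symmetric]) (simp_all add: sum_negf)
    then show ?thesis
      using assms by (simp add: prod_ennreal prod_dividef power_mult_distrib flip: of_real_power)
  qed
  then show ?thesis
    unfolding complex_gaussian_def Let_def using inv form by simp
qed

text \<open>Linear and quadratic exponents are combined so that the same identity serves twice: with s = 0 for
  integrating out one of two independent vectors, and with b = 0 for its squared norm.\<close>
lemma nn_integral_complex_gaussian_exp:
  fixes b :: "nat \<Rightarrow> complex"
  assumes v: "v > 0" and s: "s * v < 1"
  shows "(\<integral>\<^sup>+z. ennreal (exp (\<Sum>a<n. Re (cnj (b a) * z a) + s * (cmod (z a))\<^sup>2))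
            \<partial>complex_gaussian (complex_of_real v \<cdot>\<^sub>m 1\<^sub>m n))
    = ennreal (\<Prod>a<n. exp (v * (cmod (b a))\<^sup>2 / (4 * (1 - s * v))) / (1 - s * v))"
proof -
  interpret product_sigma_finite "\<lambda>a::nat. lborel :: complex measure"
    by standard
  \<comment> \<open>The term \<open>s * (cmod z)^2\<close> is absorbed into the Gaussian weight;
    \<open>c\<close> is the remaining quadratic coefficient, positive exactly because
    \<open>s * v < 1\<close>.\<close>
  define c where "c = 1 / v - s"
  have c: "c > 0" "c = (1 - s * v) / v"
    using v s by (auto simp: c_def field_simps)
  have factor: "exp (- (cmod z)\<^sup>2 / v) / (pi * v) * exp (Re (cnj \<beta> * z) + s * (cmod z)\<^sup>2)
     = 1 / (pi * v) * exp (Re (cnj \<beta> * z) - c * (cmod z)\<^sup>2)" for \<beta> z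
    by (simp add: c_def exp_add[symmetric] algebra_simps)
  have "(\<integral>\<^sup>+z. ennreal (exp (\<Sum>a<n. Re (cnj (b a) * z a) + s * (cmod (z a))\<^sup>2))
            \<partial>complex_gaussian (complex_of_real v \<cdot>\<^sub>m 1\<^sub>m n))
     = (\<integral>\<^sup>+z. (\<Prod>a<n. ennreal (exp (- (cmod (z a))\<^sup>2 / v) / (pi * v))) *
             ennreal (exp (\<Sum>a<n. Re (cnj (b a) * z a) + s * (cmod (z a))\<^sup>2)) \<partial>(\<Pi>\<^sub>M a\<in>{..<n}. lborel))"
    unfolding complex_gaussian_scalar[OF v] by (rule nn_integral_density) measurable
  also have "\<dots> = (\<integral>\<^sup>+z. (\<Prod>a<n. ennreal (1 / (pi * v) * exp (Re (cnj (b a) * z a) - c * (cmod (z a))\<^sup>2)))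
             \<partial>(\<Pi>\<^sub>M a\<in>{..<n}. lborel))"
  proof (rule nn_integral_cong)
    fix z :: "nat \<Rightarrow> complex"
    have "(\<Prod>a<n. exp (- (cmod (z a))\<^sup>2 / v) / (pi * v)) * exp (\<Sum>a<n. Re (cnj (b a) * z a) + s * (cmod (z a))\<^sup>2)
       = (\<Prod>a<n. 1 / (pi * v) * exp (Re (cnj (b a) * z a) - c * (cmod (z a))\<^sup>2))"
      by (simp only: exp_sum finite_lessThan prod.distrib[symmetric] factor)
    then show "(\<Prod>a<n. ennreal (exp (- (cmod (z a))\<^sup>2 / v) / (pi * v))) *
          ennreal (exp (\<Sum>a<n. Re (cnj (b a) * z a) + s * (cmod (z a))\<^sup>2))
        = (\<Prod>a<n. ennreal (1 / (pi * v) * exp (Re (cnj (b a) * z a) - c * (cmod (z a))\<^sup>2)))"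
      using v by (subst (1 2) prod_ennreal) (simp_all add: ennreal_mult[symmetric] prod_nonneg)
  qed
  also have "\<dots> = (\<Prod>a<n. \<integral>\<^sup>+z. ennreal (1 / (pi * v) * exp (Re (cnj (b a) * z) - c * (cmod z)\<^sup>2)) \<partial>lborel)"
    by (rule product_nn_integral_prod) auto
  also have "\<dots> = (\<Prod>a<n. ennreal (1 / (pi * v)) * ennreal (pi / c * exp ((cmod (b a))\<^sup>2 / (4 * c))))"
  proof (rule prod.cong[OF refl])
    fix a
    have "(\<integral>\<^sup>+z. ennreal (1 / (pi * v) * exp (Re (cnj (b a) * z) - c * (cmod z)\<^sup>2)) \<partial>lborel)
        = (\<integral>\<^sup>+z. ennreal (1 / (pi * v)) * ennreal (exp (Re (cnj (b a) * z) - c * (cmod z)\<^sup>2)) \<partial>lborel)"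
      using v by (intro nn_integral_cong ennreal_mult) auto
    also have "\<dots> = ennreal (1 / (pi * v)) * (\<integral>\<^sup>+z. ennreal (exp (Re (cnj (b a) * z) - c * (cmod z)\<^sup>2)) \<partial>lborel)"
      by (rule nn_integral_cmult) measurable
    finally show "(\<integral>\<^sup>+z. ennreal (1 / (pi * v) * exp (Re (cnj (b a) * z) - c * (cmod z)\<^sup>2)) \<partial>lborel)
        = ennreal (1 / (pi * v)) * ennreal (pi / c * exp ((cmod (b a))\<^sup>2 / (4 * c)))"
      by (simp only: nn_integral_exp_quadratic_complex[OF c(1)])
  qed
  also have "\<dots> = (\<Prod>a<n. ennreal (exp (v * (cmod (b a))\<^sup>2 / (4 * (1 - s * v))) / (1 - s * v)))"
  proof (rule prod.cong[OF refl])
    fix a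
    have "1 / (pi * v) * (pi / c * exp ((cmod (b a))\<^sup>2 / (4 * c)))
        = exp (v * (cmod (b a))\<^sup>2 / (4 * (1 - s * v))) / (1 - s * v)"
      using v s by (simp add: c(2) field_simps)
    then show "ennreal (1 / (pi * v)) * ennreal (pi / c * exp ((cmod (b a))\<^sup>2 / (4 * c)))
        = ennreal (exp (v * (cmod (b a))\<^sup>2 / (4 * (1 - s * v))) / (1 - s * v))"
      using v c(1) by (subst ennreal_mult[symmetric]) auto
  qed
  also have "\<dots> = ennreal (\<Prod>a<n. exp (v * (cmod (b a))\<^sup>2 / (4 * (1 - s * v))) / (1 - s * v))"
    using s by (intro prod_ennreal) auto
  finally show ?thesis .
qed

section \<open>Almost sure asymptotics of Gaussian inner products\<close>

lemma borel_measurable_inner_sum: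
  fixes f g :: "'a \<Rightarrow> nat \<Rightarrow> complex"
  assumes f: "f \<in> measurable N (\<Pi>\<^sub>M a\<in>{..<n}. borel)" and g: "g \<in> measurable N (\<Pi>\<^sub>M a\<in>{..<n}. borel)"
  shows "(\<lambda>x. \<Sum>a<n. cnj (f x a) * g x a) \<in> borel_measurable N"
proof (intro borel_measurable_sum borel_measurable_times)
  fix a assume "a \<in> {..<n}"
  then have "(\<lambda>x. f x a) \<in> borel_measurable N" and g: "(\<lambda>x. g x a) \<in> borel_measurable N"
    using measurable_compose[OF f measurable_component_singleton] measurable_compose[OF g measurable_component_singleton]
    by auto
  then show "(\<lambda>x. cnj (f x a)) \<in> borel_measurable N"
    by (rule_tac borel_measurable_continuous_on[where f = cnj]) (auto intro: continuous_intros)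
  show "(\<lambda>x. g x a) \<in> borel_measurable N" by (rule g)
qed

context prob_space
begin

text \<open>Given \<open>X\<close>, the exponent is a real Gaussian of variance
  \<open>w * |c|^2 * |X|^2 / 2\<close>, so integrating over \<open>Y\<close> leaves
  \<open>exp (w * |c|^2 / 4 * |X|^2)\<close>. The bound assumed on \<open>c\<close> is what makes
  this integrable against the law of \<open>X\<close>.\<close>

lemma nn_integral_exp_gaussian_inner:
  fixes c :: complex
  assumes v: "v > 0" and w: "w > 0" and c: "w * (cmod c)\<^sup>2 / 4 * v < 1"
    and ind: "indep_var (\<Pi>\<^sub>M a\<in>{..<n}. borel) X (\<Pi>\<^sub>M a\<in>{..<n}. borel) Y"
    and X: "distr M (\<Pi>\<^sub>M a\<in>{..<n}. borel) X = complex_gaussian (complex_of_real v \<cdot>\<^sub>m 1\<^sub>m n)"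
    and Y: "distr M (\<Pi>\<^sub>M a\<in>{..<n}. borel) Y = complex_gaussian (complex_of_real w \<cdot>\<^sub>m 1\<^sub>m n)"
  shows "(\<integral>\<^sup>+\<omega>. ennreal (exp (Re (c * (\<Sum>a<n. cnj (X \<omega> a) * Y \<omega> a)))) \<partial>M)
           = ennreal ((1 / (1 - w * (cmod c)\<^sup>2 / 4 * v)) ^ n)"
proof -
  let ?P = "(\<Pi>\<^sub>M a\<in>{..<n}. borel) :: (nat \<Rightarrow> complex) measure"
  let ?X = "distr M ?P X" and ?Y = "distr M ?P Y"
  let ?f = "\<lambda>x y. ennreal (exp (Re (c * (\<Sum>a<n. cnj (x a) * y a))))"
  have [measurable]: "random_variable ?P X" "random_variable ?P Y"
    and joint: "?X \<Otimes>\<^sub>M ?Y = distr M (?P \<Otimes>\<^sub>M ?P) (\<lambda>\<omega>. (X \<omega>, Y \<omega>))"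
    using ind unfolding indep_var_distribution_eq by auto
  interpret Y: prob_space ?Y by (rule prob_space_distr) measurable
  have [measurable]: "(\<lambda>p. ?f (fst p) (snd p)) \<in> borel_measurable (?P \<Otimes>\<^sub>M ?P)"
    using borel_measurable_inner_sum[of fst "?P \<Otimes>\<^sub>M ?P" n snd] by measurable
  have "(\<integral>\<^sup>+\<omega>. ?f (X \<omega>) (Y \<omega>) \<partial>M) = (\<integral>\<^sup>+p. ?f (fst p) (snd p) \<partial>(?X \<Otimes>\<^sub>M ?Y))"
    unfolding joint by (subst nn_integral_distr) simp_all
  also have "\<dots> = (\<integral>\<^sup>+x. \<integral>\<^sup>+y. ?f x y \<partial>?Y \<partial>?X)"
    by (subst Y.nn_integral_fst[symmetric]) simp_all
  also have "\<dots> = (\<integral>\<^sup>+x. ennreal (exp (\<Sum>a<n. Re (cnj 0 * x a) + w * (cmod c)\<^sup>2 / 4 * (cmod (x a))\<^sup>2)) \<partial>?X)"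
  proof (rule nn_integral_cong)
    fix x :: "nat \<Rightarrow> complex"
    \<comment> \<open>The scalar moves into the coefficient vector: the inner integral is the linear
      case with \<open>b a = cnj c * x a\<close>.\<close>
    have "c * (\<Sum>a<n. cnj (x a) * y a) = (\<Sum>a<n. cnj (cnj c * x a) * y a)" for y
      by (simp add: sum_distrib_left mult.assoc)
    then have "(\<integral>\<^sup>+y. ?f x y \<partial>?Y)
        = (\<integral>\<^sup>+y. ennreal (exp (\<Sum>a<n. Re (cnj (cnj c * x a) * y a) + 0 * (cmod (y a))\<^sup>2)) \<partial>?Y)"
      by (simp only: Re_sum mult_zero_left add_0_right)
    also have "\<dots> = ennreal (exp (\<Sum>a<n. Re (cnj 0 * x a) + w * (cmod c)\<^sup>2 / 4 * (cmod (x a))\<^sup>2))"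
      unfolding Y using w
      by (subst nn_integral_complex_gaussian_exp) (simp_all add: exp_sum norm_mult power_mult_distrib mult_ac)
    finally show "(\<integral>\<^sup>+y. ?f x y \<partial>?Y) = \<dots>" .
  qed
  also have "\<dots> = ennreal (\<Prod>a<n. exp (v * (cmod 0)\<^sup>2 / (4 * (1 - w * (cmod c)\<^sup>2 / 4 * v))) / (1 - w * (cmod c)\<^sup>2 / 4 * v))"
    unfolding X by (rule nn_integral_complex_gaussian_exp[OF v c])
  finally show ?thesis by simp
qed

text \<open>First Borel-Cantelli lemma with a geometric series as majorant. The offset
  \<open>k\<close> is present because the channel model only speaks of N \<ge> K.\<close>

lemma AE_eventually_not_of_geometric_bound:
  assumes meas: "\<And>n. n \<ge> k \<Longrightarrow> {\<omega> \<in> space M. P n \<omega>} \<in> events"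
    and bound: "\<And>n. n \<ge> k \<Longrightarrow> emeasure M {\<omega> \<in> space M. P n \<omega>} \<le> ennreal (q ^ n)"
    and q: "0 \<le> q" "q < 1"
  shows "AE \<omega> in M. eventually (\<lambda>n. \<not> P n \<omega>) sequentially"
proof -
  \<comment> \<open>Below \<open>k\<close> not even measurability of \<open>P n\<close> is known;
    the empty set is a harmless replacement for finitely many indices.\<close>
  define A where "A n = (if n \<ge> k then {\<omega> \<in> space M. P n \<omega>} else {})" for n
  have A: "A n \<in> events" for n
    using meas by (simp add: A_def)
  have le: "prob (A n) \<le> q ^ n" for n
    using bound[of n] q by (auto simp: A_def emeasure_eq_measure)
  have "summable (\<lambda>n. prob (A n))"
    by (rule summable_comparison_test'[where g = "\<lambda>n. q ^ n" and N = 0])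
       (use q le in \<open>auto intro: summable_geometric\<close>)
  then have "AE \<omega> in M. eventually (\<lambda>n. \<omega> \<in> space M - A n) sequentially"
    using A by (intro borel_cantelli_AE1) (auto simp: emeasure_eq_measure)
  then show ?thesis
  proof (rule AE_mp, intro AE_I2 impI)
    fix \<omega> assume "eventually (\<lambda>n. \<omega> \<in> space M - A n) sequentially"
    then show "eventually (\<lambda>n. \<not> P n \<omega>) sequentially"
      using eventually_ge_at_top[of k]
      by eventually_elim (auto simp: A_def)
  qed
qed

end

text \<open>To first order in \<open>t\<close> the quotient is \<open>1 - t * \<epsilon>\<close>, as
  the denominator deviates from 1 only quadratically; a small \<open>t\<close> therefore gives a
  value below 1.\<close>

lemma exists_chernoff_parameter:
  fixes u \<epsilon> :: real
  assumes "u > 0" "\<epsilon> > 0"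
  obtains t where "t > 0" "u * t\<^sup>2 < 1" "exp (- t * \<epsilon>) / (1 - u * t\<^sup>2) < 1"
proof
  \<comment> \<open>The first bound gives \<open>t * \<epsilon> \<le> 1\<close>, the second
    \<open>u * t^2 \<le> t * \<epsilon> / 4\<close>. Together they make
    \<open>(1 - u * t^2) * (1 + t * \<epsilon>)\<close> at least
    \<open>1 + t * \<epsilon> / 2\<close>, and \<open>1 + x \<le> exp x\<close> concludes.\<close>
  define t where "t = min (1 / \<epsilon>) (\<epsilon> / (4 * u))"
  show t: "t > 0" using assms by (simp add: t_def)
  have t\<epsilon>: "t * \<epsilon> \<le> 1" and ut: "u * t \<le> \<epsilon> / 4"
    using assms mult_right_mono[of t "1 / \<epsilon>" \<epsilon>] mult_left_mono[of t "\<epsilon> / (4 * u)" u]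
    by (auto simp: t_def)
  have "u * t\<^sup>2 = u * t * t" by (simp add: power2_eq_square)
  also have "\<dots> \<le> \<epsilon> / 4 * t" using ut t by (intro mult_right_mono) auto
  finally have ut2: "u * t\<^sup>2 \<le> t * \<epsilon> / 4" by (simp add: mult.commute)
  then show 1: "u * t\<^sup>2 < 1" using t\<epsilon> by simp
  have "1 < (1 - u * t\<^sup>2) * (1 + t * \<epsilon>)"
  proof -
    have "u * t\<^sup>2 * (1 + t * \<epsilon>) \<le> t * \<epsilon> / 4 * 2"
      using ut2 t\<epsilon> t assms by (intro mult_mono) auto
    moreover have "t * \<epsilon> > 0" using t assms by simp
    ultimately show ?thesis by (simp add: algebra_simps)
  qed
  also have "\<dots> \<le> (1 - u * t\<^sup>2) * exp (t * \<epsilon>)"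
    using 1 exp_ge_add_one_self[of "t * \<epsilon>"] by (intro mult_left_mono) auto
  finally show "exp (- t * \<epsilon>) / (1 - u * t\<^sup>2) < 1"
    using 1 by (simp add: exp_minus field_simps)
qed

context prob_space
begin

text \<open>Chernoff's inequality needs a real quantity, so the complex sum is projected to the
  direction given by the unit scalar \<open>c\<close>. Its exponential moment is the one with scalar
  \<open>t * c\<close>, which explains the constant \<open>w * v / 4\<close> in the choice of
  \<open>t\<close>.\<close>

lemma AE_eventually_gaussian_inner_less:
  fixes X Y :: "nat \<Rightarrow> 'a \<Rightarrow> nat \<Rightarrow> complex"
  assumes v: "v > 0" and w: "w > 0"
    and ind: "\<And>n. n \<ge> k \<Longrightarrow> indep_var (\<Pi>\<^sub>M a\<in>{..<n}. borel) (X n) (\<Pi>\<^sub>M a\<in>{..<n}. borel) (Y n)"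
    and X: "\<And>n. n \<ge> k \<Longrightarrow> distr M (\<Pi>\<^sub>M a\<in>{..<n}. borel) (X n) = complex_gaussian (complex_of_real v \<cdot>\<^sub>m 1\<^sub>m n)"
    and Y: "\<And>n. n \<ge> k \<Longrightarrow> distr M (\<Pi>\<^sub>M a\<in>{..<n}. borel) (Y n) = complex_gaussian (complex_of_real w \<cdot>\<^sub>m 1\<^sub>m n)"
    and c: "cmod c = 1" and \<epsilon>: "\<epsilon> > 0"
  shows "AE \<omega> in M. eventually (\<lambda>n. Re (c * (\<Sum>a<n. cnj (X n \<omega> a) * Y n \<omega> a)) < real n * \<epsilon>) sequentially"
proof -
  obtain t where t: "t > 0" "w * v / 4 * t\<^sup>2 < 1" "exp (- t * \<epsilon>) / (1 - w * v / 4 * t\<^sup>2) < 1"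
    using exists_chernoff_parameter[of "w * v / 4" \<epsilon>] v w \<epsilon> by auto
  define q where "q = exp (- t * \<epsilon>) / (1 - w * v / 4 * t\<^sup>2)"
  let ?S = "\<lambda>n \<omega>. \<Sum>a<n. cnj (X n \<omega> a) * Y n \<omega> a"
  have meas [measurable]: "(\<lambda>\<omega>. Re (c * ?S n \<omega>)) \<in> borel_measurable M" if "n \<ge> k" for n
  proof -
    have [measurable]: "X n \<in> measurable M (\<Pi>\<^sub>M a\<in>{..<n}. borel)" "Y n \<in> measurable M (\<Pi>\<^sub>M a\<in>{..<n}. borel)"
      using ind[OF that] unfolding indep_var_distribution_eq by auto
    show ?thesis
      using borel_measurable_inner_sum[of "X n" M n "Y n"] by measurable
  qed
  have "AE \<omega> in M. eventually (\<lambda>n. \<not> (Re (c * ?S n \<omega>) \<ge> real n * \<epsilon>)) sequentially"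
  proof (rule AE_eventually_not_of_geometric_bound[where k = k and q = q])
    fix n assume n: "n \<ge> k"
    note [measurable] = meas[OF n]
    show "{\<omega> \<in> space M. real n * \<epsilon> \<le> Re (c * ?S n \<omega>)} \<in> events"
      by measurable
    have "emeasure M {\<omega> \<in> space M. real n * \<epsilon> \<le> Re (c * ?S n \<omega>)}
        \<le> ennreal (exp (- t * (real n * \<epsilon>))) * (\<integral>\<^sup>+\<omega>. ennreal (exp (t * Re (c * ?S n \<omega>))) * indicator (space M) \<omega> \<partial>M)"
      by (intro Chernoff_ineq_nn_integral_ge t(1) borel_measurable_times meas[OF n] borel_measurable_indicator sets.top)
    also have "(\<integral>\<^sup>+\<omega>. ennreal (exp (t * Re (c * ?S n \<omega>))) * indicator (space M) \<omega> \<partial>M)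
        = (\<integral>\<^sup>+\<omega>. ennreal (exp (Re ((of_real t * c) * ?S n \<omega>))) \<partial>M)"
    proof (rule nn_integral_cong)
      fix \<omega> assume "\<omega> \<in> space M"
      moreover have "Re ((of_real t * c) * ?S n \<omega>) = t * Re (c * ?S n \<omega>)"
        by (simp only: mult.assoc times_complex.sel(1) Re_complex_of_real Im_complex_of_real mult_zero_left diff_zero)
      ultimately show "ennreal (exp (t * Re (c * ?S n \<omega>))) * indicator (space M) \<omega>
         = ennreal (exp (Re ((of_real t * c) * ?S n \<omega>)))"
        by simp
    qed
    also have "\<dots> = ennreal ((1 / (1 - w * (cmod (of_real t * c))\<^sup>2 / 4 * v)) ^ n)"
      using t c by (intro nn_integral_exp_gaussian_inner v w ind[OF n] X[OF n] Y[OF n])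
        (simp add: norm_mult mult_ac)
    also have "ennreal (exp (- t * (real n * \<epsilon>))) * \<dots> = ennreal (q ^ n)"
      using t c by (subst ennreal_mult[symmetric])
        (auto simp: q_def norm_mult power_divide exp_of_nat_mult[symmetric] mult_ac)
    finally show "emeasure M {\<omega> \<in> space M. real n * \<epsilon> \<le> Re (c * ?S n \<omega>)} \<le> ennreal (q ^ n)" .
  qed (use t in \<open>auto simp: q_def\<close>)
  then show ?thesis by (simp only: not_le)
qed

text \<open>The directions 1, -1, \<open>\<i>\<close>, \<open>-\<i>\<close> bound the real and
  imaginary parts from both sides. Thresholds are restricted to \<open>1 / (m + 1)\<close> so that
  only countably many null sets are united.\<close>

lemma AE_gaussian_inner_mean_tendsto_0:
  fixes X Y :: "nat \<Rightarrow> 'a \<Rightarrow> nat \<Rightarrow> complex"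
  assumes "v > 0" "w > 0"
    and "\<And>n. n \<ge> k \<Longrightarrow> indep_var (\<Pi>\<^sub>M a\<in>{..<n}. borel) (X n) (\<Pi>\<^sub>M a\<in>{..<n}. borel) (Y n)"
    and "\<And>n. n \<ge> k \<Longrightarrow> distr M (\<Pi>\<^sub>M a\<in>{..<n}. borel) (X n) = complex_gaussian (complex_of_real v \<cdot>\<^sub>m 1\<^sub>m n)"
    and "\<And>n. n \<ge> k \<Longrightarrow> distr M (\<Pi>\<^sub>M a\<in>{..<n}. borel) (Y n) = complex_gaussian (complex_of_real w \<cdot>\<^sub>m 1\<^sub>m n)"
  shows "AE \<omega> in M. (\<lambda>n. (\<Sum>a<n. cnj (X n \<omega> a) * Y n \<omega> a) / of_nat n) \<longlonglongrightarrow> 0"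
proof -
  let ?S = "\<lambda>n \<omega>. \<Sum>a<n. cnj (X n \<omega> a) * Y n \<omega> a"
  have "AE \<omega> in M. \<forall>m. \<forall>c\<in>{1, -1, \<i>, -\<i>}.
      eventually (\<lambda>n. Re (c * ?S n \<omega>) < real n * inverse (real (Suc m))) sequentially"
    by (subst AE_all_countable, intro allI, subst AE_ball_countable, simp, intro ballI,
        rule AE_eventually_gaussian_inner_less[OF assms]) auto
  then show ?thesis
  proof (rule AE_mp, intro AE_I2 impI)
    fix \<omega>
    assume *: "\<forall>m. \<forall>c\<in>{1, -1, \<i>, -\<i>}.
      eventually (\<lambda>n. Re (c * ?S n \<omega>) < real n * inverse (real (Suc m))) sequentially"
    show "(\<lambda>n. ?S n \<omega> / of_nat n) \<longlonglongrightarrow> 0"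
    proof (rule tendstoI)
      fix e :: real assume "e > 0"
      \<comment> \<open>Half of \<open>e\<close>, because the modulus is estimated by the sum of the
        absolute real and imaginary parts.\<close>
      then obtain m where m: "inverse (real (Suc m)) < e / 2"
        using reals_Archimedean[of "e / 2"] by auto
      define r where "r = inverse (real (Suc m))"
      have *: "eventually (\<lambda>n. Re (c * ?S n \<omega>) < real n * r) sequentially" if "c \<in> {1, -1, \<i>, -\<i>}" for c
        using * that unfolding r_def by blast
      have "eventually (\<lambda>n. Re (1 * ?S n \<omega>) < real n * r) sequentially"
        and "eventually (\<lambda>n. Re (- 1 * ?S n \<omega>) < real n * r) sequentially"
        and "eventually (\<lambda>n. Re (\<i> * ?S n \<omega>) < real n * r) sequentially"
        and "eventually (\<lambda>n. Re (- \<i> * ?S n \<omega>) < real n * r) sequentially"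
        by (rule *, simp)+
      then show "eventually (\<lambda>n. dist (?S n \<omega> / of_nat n) 0 < e) sequentially"
        using eventually_gt_at_top[of 0]
      proof eventually_elim
        case (elim n)
        define z where "z = ?S n \<omega>"
        have "Re z < n * r" "- Re z < n * r" "- Im z < n * r" "Im z < n * r"
          using elim(1-4) unfolding z_def[symmetric] by simp_all
        then have "cmod z \<le> real n * r + real n * r"
          using cmod_le[of z] by linarith
        also have "\<dots> < real n * e"
          using m elim(5) by (simp add: r_def flip: distrib_left)
        finally have "cmod z < real n * e" .
        then show ?case
          using elim(5) by (simp only: z_def[symmetric] dist_0_norm dist_norm diff_zero norm_divide norm_of_nat)
              (simp add: field_simps)
      qed
    qed
  qed
qed

text \<open>Lower-tail Chernoff bound with parameter \<open>1 / v\<close>: each coordinate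
  contributes the moment \<open>1 / (1 + 1) = 1 / 2\<close>, and the threshold \<open>v / 2\<close>
  costs a factor \<open>exp (1 / 2)\<close>.\<close>

lemma AE_eventually_gaussian_norm_gt:
  fixes X :: "nat \<Rightarrow> 'a \<Rightarrow> nat \<Rightarrow> complex"
  assumes v: "v > 0"
    and X_meas: "\<And>n. n \<ge> k \<Longrightarrow> random_variable (\<Pi>\<^sub>M a\<in>{..<n}. borel) (X n)"
    and X: "\<And>n. n \<ge> k \<Longrightarrow> distr M (\<Pi>\<^sub>M a\<in>{..<n}. borel) (X n) = complex_gaussian (complex_of_real v \<cdot>\<^sub>m 1\<^sub>m n)"
  shows "AE \<omega> in M. eventually (\<lambda>n. (\<Sum>a<n. (cmod (X n \<omega> a))\<^sup>2) > real n * (v / 2)) sequentially"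
proof -
  let ?S = "\<lambda>n \<omega>. \<Sum>a<n. (cmod (X n \<omega> a))\<^sup>2"
  define q :: real where "q = exp (1 / 2) / 2"
  \<comment> \<open>Squaring reduces this to e < 4.\<close>
  have "exp (1 / 2 :: real) < 2"
  proof -
    have "exp (1 / 2 :: real) ^ 2 < 2 ^ 2"
      using exp_le by (simp add: exp_of_nat_mult[symmetric])
    then show ?thesis by (rule power_less_imp_less_base) simp
  qed
  then have q: "0 \<le> q" "q < 1" by (auto simp: q_def)
  have "AE \<omega> in M. eventually (\<lambda>n. \<not> (?S n \<omega> \<le> real n * (v / 2))) sequentially"
  proof (rule AE_eventually_not_of_geometric_bound[where k = k and q = q])
    fix n assume n: "n \<ge> k"
    note [measurable] = X_meas[OF n]
    show "{\<omega> \<in> space M. ?S n \<omega> \<le> real n * (v / 2)} \<in> events"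
      using measurable_compose[OF X_meas[OF n] measurable_component_singleton] by measurable
    have "emeasure M {\<omega> \<in> space M. ?S n \<omega> \<le> real n * (v / 2)}
       \<le> ennreal (exp ((1 / v) * (real n * (v / 2)))) * (\<integral>\<^sup>+\<omega>. ennreal (exp (- (1 / v) * ?S n \<omega>)) * indicator (space M) \<omega> \<partial>M)"
      using v by (intro Chernoff_ineq_nn_integral_le) auto
    also have "(\<integral>\<^sup>+\<omega>. ennreal (exp (- (1 / v) * ?S n \<omega>)) * indicator (space M) \<omega> \<partial>M)
      = (\<integral>\<^sup>+\<omega>. ennreal (exp (\<Sum>a<n. Re (cnj 0 * X n \<omega> a) + - (1 / v) * (cmod (X n \<omega> a))\<^sup>2)) \<partial>M)"
      by (intro nn_integral_cong) (simp add: sum_distrib_left)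
    also have "\<dots> = (\<integral>\<^sup>+x. ennreal (exp (\<Sum>a<n. Re (cnj 0 * x a) + - (1 / v) * (cmod (x a))\<^sup>2))
        \<partial>distr M (\<Pi>\<^sub>M a\<in>{..<n}. borel) (X n))"
      by (subst nn_integral_distr) simp_all
    also have "\<dots> = ennreal (\<Prod>a<n. exp (v * (cmod 0)\<^sup>2 / (4 * (1 - (- (1 / v)) * v))) / (1 - (- (1 / v)) * v))"
      unfolding X[OF n] using v by (intro nn_integral_complex_gaussian_exp) simp_all
    also have "\<dots> = ennreal ((1 / 2) ^ n)"
      using v by simp
    also have "ennreal (exp ((1 / v) * (real n * (v / 2)))) * \<dots> = ennreal (q ^ n)"
      using v by (subst ennreal_mult[symmetric])
        (auto simp: q_def power_divide exp_of_nat_mult[symmetric])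
    finally show "emeasure M {\<omega> \<in> space M. ?S n \<omega> \<le> real n * (v / 2)} \<le> ennreal (q ^ n)" .
  qed (use q in auto)
  then show ?thesis by (simp only: not_le)
qed

end

section \<open>The zero-forcing row of a nearly orthogonal channel\<close>

lemma index_mat_adjoint:
  fixes A :: "complex mat"
  assumes "i < dim_col A" "j < dim_row A"
  shows "mat_adjoint A $$ (i, j) = cnj (A $$ (j, i))"
  using assms by (simp add: mat_adjoint_def mat_of_rows_def conjugate_complex_def)

lemma dim_mat_adjoint [simp]:
  "dim_row (mat_adjoint A) = dim_col A" "dim_col (mat_adjoint A) = dim_row A"
  by (simp_all add: mat_adjoint_def)

lemma vec_norm2_squared: "(vec_norm2 x)\<^sup>2 = (\<Sum>i<dim_vec x. (cmod (x $ i))\<^sup>2)"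
  by (simp add: vec_norm2_def L2_set_def sum_nonneg)

text \<open>At an index \<open>m\<close> where \<open>cmod (x m)\<close> is maximal, equation
  \<open>m\<close> gives \<open>c * |x m| \<le> b + n * d * |x m|\<close>, and the last term is at
  most half of the left side. The system acts on row vectors because a row of an inverse will be
  estimated.\<close>

lemma diag_dominant_solution_bound:
  fixes x y :: "nat \<Rightarrow> complex" and P :: "nat \<Rightarrow> nat \<Rightarrow> complex"
  assumes sol: "\<And>j. j < n \<Longrightarrow> (\<Sum>m<n. x m * P m j) = y j"
    and y: "\<And>j. j < n \<Longrightarrow> cmod (y j) \<le> b"
    and diag: "\<And>j. j < n \<Longrightarrow> c \<le> cmod (P j j)"
    and off: "\<And>m j. m < n \<Longrightarrow> j < n \<Longrightarrow> m \<noteq> j \<Longrightarrow> cmod (P m j) \<le> d"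
    and c: "c > 0" and d: "d \<ge> 0" "real n * d \<le> c / 2" and j: "j < n"
  shows "cmod (x j) \<le> 2 * b / c"
proof -
  obtain m where m: "m < n" and max: "\<And>i. i < n \<Longrightarrow> cmod (x i) \<le> cmod (x m)"
  proof -
    have "Max ((\<lambda>i. cmod (x i)) ` {..<n}) \<in> (\<lambda>i. cmod (x i)) ` {..<n}"
      using j by (intro Max_in) auto
    then obtain m where "m < n" "Max ((\<lambda>i. cmod (x i)) ` {..<n}) = cmod (x m)" by auto
    moreover have "cmod (x i) \<le> Max ((\<lambda>i. cmod (x i)) ` {..<n})" if "i < n" for i
      using that by (intro Max_ge) auto
    ultimately show ?thesis using that by auto
  qed
  have "x m * P m m = y m - (\<Sum>i\<in>{..<n} - {m}. x i * P i m)"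
    using sol[OF m] m by (simp add: sum.remove[of _ m] algebra_simps)
  then have "cmod (x m) * cmod (P m m) \<le> cmod (y m) + cmod (\<Sum>i\<in>{..<n} - {m}. x i * P i m)"
    by (metis norm_mult norm_triangle_ineq4)
  also have "cmod (\<Sum>i\<in>{..<n} - {m}. x i * P i m) \<le> (\<Sum>i\<in>{..<n} - {m}. cmod (x m) * d)"
    using max off m by (intro sum_norm_le) (auto simp: norm_mult intro!: mult_mono)
  also have "\<dots> \<le> real n * (cmod (x m) * d)"
    using d m by (simp add: mult_right_mono)
  also have "\<dots> \<le> cmod (x m) * (c / 2)"
    using mult_left_mono[OF d(2), of "cmod (x m)"] by (simp add: mult_ac)
  finally have "cmod (x m) * cmod (P m m) \<le> b + cmod (x m) * (c / 2)"
    using y[OF m] by linarith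
  moreover have "cmod (x m) * c \<le> cmod (x m) * cmod (P m m)"
    using diag[OF m] by (intro mult_left_mono) auto
  ultimately have "cmod (x m) \<le> 2 * b / c"
    using c by (simp add: field_simps)
  with max[OF j] show ?thesis by simp
qed

text \<open>Invertibility is the homogeneous case of the preceding estimate: with
  \<open>b = 0\<close> every kernel vector vanishes.\<close>

lemma diag_dominant_mat_inverse:
  fixes A :: "complex mat"
  assumes A: "A \<in> carrier_mat n n"
    and diag: "\<And>j. j < n \<Longrightarrow> c \<le> cmod (A $$ (j, j))"
    and off: "\<And>m j. m < n \<Longrightarrow> j < n \<Longrightarrow> m \<noteq> j \<Longrightarrow> cmod (A $$ (m, j)) \<le> d"
    and c: "c > 0" and d: "d \<ge> 0" "real n * d \<le> c / 2"
  obtains B where "mat_inverse A = Some B" "B \<in> carrier_mat n n" "B * A = 1\<^sub>m n"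
proof -
  \<comment> \<open>The transpose appears because the estimate concerns x A = 0, that is, the kernel
    of the transposed matrix.\<close>
  have "det (transpose_mat A) \<noteq> 0"
  proof
    assume "det (transpose_mat A) = 0"
    then obtain x where x: "x \<in> carrier_vec n" "x \<noteq> 0\<^sub>v n" "transpose_mat A *\<^sub>v x = 0\<^sub>v n"
      using A det_0_iff_vec_prod_zero[of "transpose_mat A" n] by auto
    have "(\<Sum>m<n. x $ m * A $$ (m, j)) = 0" if j: "j < n" for j
    proof -
      have "(transpose_mat A *\<^sub>v x) $ j = 0" using x j by simp
      then show ?thesis
        using A x(1) j by (simp add: scalar_prod_def lessThan_atLeast0 mult.commute)
    qed
    note sol = this
    have "cmod (x $ j) \<le> 2 * 0 / c" if "j < n" for j
      by (rule diag_dominant_solution_bound[where x = "\<lambda>m. x $ m" and P = "\<lambda>m j. A $$ (m, j)" and y = "\<lambda>_. 0"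
            and n = n and d = d, OF sol _ diag off c d that]) auto
    then have "x $ j = 0" if "j < n" for j
      using that by simp
    with x show False by (auto intro: eq_vecI)
  qed
  then have "A \<in> Units (ring_mat TYPE(complex) n ())"
    using det_non_zero_imp_unit[OF A] A by (simp add: det_transpose)
  then obtain B where "mat_inverse A = Some B"
    using mat_inverse(1)[OF A, of "()"] by (cases "mat_inverse A") auto
  with mat_inverse(2)[OF A this] that show thesis by blast
qed

text \<open>Here h is row k of the inverse Gram matrix.\<close>
lemma zf_pinv_row:
  fixes G :: "complex mat"
  assumes G: "G \<in> carrier_mat N K" and k: "k < K"
    and diag: "\<And>j. j < K \<Longrightarrow> c \<le> (\<Sum>a<N. (cmod (G $$ (a, j)))\<^sup>2)"
    and off: "\<And>m j. m < K \<Longrightarrow> j < K \<Longrightarrow> m \<noteq> j \<Longrightarrow> cmod (\<Sum>a<N. cnj (G $$ (a, m)) * G $$ (a, j)) \<le> d"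
    and c: "c > 0" and d: "d \<ge> 0" "real K * d \<le> c / 2"
  obtains h where "\<And>j. j < K \<Longrightarrow> cmod (h j) \<le> 2 / c"
    and "row (zf_pinv G) k = vec N (\<lambda>a. \<Sum>m<K. h m * cnj (G $$ (a, m)))"
    and "\<And>j. j < K \<Longrightarrow> (\<Sum>m<K. h m * (\<Sum>a<N. cnj (G $$ (a, m)) * G $$ (a, j))) = (if j = k then 1 else 0)"
proof -
  let ?P = "mat_adjoint G * G"
  have P: "?P \<in> carrier_mat K K" using G by auto
  have Pmj: "?P $$ (m, j) = (\<Sum>a<N. cnj (G $$ (a, m)) * G $$ (a, j))" if "m < K" "j < K" for m j
    using G that by (simp add: scalar_prod_def index_mat_adjoint lessThan_atLeast0)
  have diag': "c \<le> cmod (?P $$ (j, j))" if "j < K" for j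
  proof -
    have "?P $$ (j, j) = of_real (\<Sum>a<N. (cmod (G $$ (a, j)))\<^sup>2)"
      using that by (simp add: Pmj complex_norm_square mult.commute del: of_real_power)
    then show ?thesis
      using diag[OF that] c by (simp only: norm_of_real)
  qed
  have off': "cmod (?P $$ (m, j)) \<le> d" if "m < K" "j < K" "m \<noteq> j" for m j
    using off[OF that] Pmj that by simp
  obtain R where R: "mat_inverse ?P = Some R" "R \<in> carrier_mat K K" "R * ?P = 1\<^sub>m K"
    by (rule diag_dominant_mat_inverse[OF P diag' off' c d]) blast+
  have sol: "(\<Sum>m<K. R $$ (k, m) * ?P $$ (m, j)) = (if j = k then 1 else 0)" if "j < K" for j
  proof -
    have "(R * ?P) $$ (k, j) = (\<Sum>m<K. R $$ (k, m) * ?P $$ (m, j))"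
      using R(2) P k that by (simp add: scalar_prod_def lessThan_atLeast0 del: index_mult_mat(1))
          (subst index_mult_mat(1), auto simp: scalar_prod_def)
    then show ?thesis unfolding R(3) using k that by auto
  qed
  show thesis
  proof
    show "cmod (R $$ (k, j)) \<le> 2 / c" if "j < K" for j
    proof -
      \<comment> \<open>The right-hand side is the unit vector e_k, so its entries are bounded by
        \<open>b = 1\<close>.\<close>
      have "cmod (R $$ (k, j)) \<le> 2 * 1 / c"
        by (rule diag_dominant_solution_bound[where x = "\<lambda>m. R $$ (k, m)" and P = "\<lambda>m j. ?P $$ (m, j)"
            and n = K and d = d, OF sol _ diag' off' c d that]) auto
      then show ?thesis by simp
    qed
    show "row (zf_pinv G) k = vec N (\<lambda>a. \<Sum>m<K. R $$ (k, m) * cnj (G $$ (a, m)))"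
      using G R k by (intro eq_vecI)
        (simp_all add: zf_pinv_def scalar_prod_def lessThan_atLeast0 index_mat_adjoint)
    show "(\<Sum>m<K. R $$ (k, m) * (\<Sum>a<N. cnj (G $$ (a, m)) * G $$ (a, j))) = (if j = k then 1 else 0)" if "j < K" for j
      using sol[OF that] that by (simp add: Pmj)
  qed
qed

text \<open>Interchanging the sums writes g B as h (G^H B), so that N enters only through inner
  products of columns and the outer sum has the fixed length K.\<close>

lemma transpose_mult_zf_row:
  fixes G B :: "complex mat"
  assumes "B \<in> carrier_mat N K'" and "j < K'"
  shows "(transpose_mat B *\<^sub>v vec N (\<lambda>a. \<Sum>m<K. h m * cnj (G $$ (a, m)))) $ j
       = (\<Sum>m<K. h m * (\<Sum>a<N. cnj (G $$ (a, m)) * B $$ (a, j)))"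
proof -
  have "(transpose_mat B *\<^sub>v vec N (\<lambda>a. \<Sum>m<K. h m * cnj (G $$ (a, m)))) $ j
      = (\<Sum>a<N. \<Sum>m<K. h m * (cnj (G $$ (a, m)) * B $$ (a, j)))"
    using assms by (simp add: scalar_prod_def lessThan_atLeast0 sum_distrib_left mult_ac)
  also have "\<dots> = (\<Sum>m<K. \<Sum>a<N. h m * (cnj (G $$ (a, m)) * B $$ (a, j)))"
    by (rule sum.swap)
  finally show ?thesis by (simp add: sum_distrib_left)
qed

text \<open>The three claims treat the noise, the pilot contamination and the channel errors in the
  SINR denominator. The first two rest on g G = e_k, the third on the entrywise bound for h.\<close>

lemma zf_pinv_row_bounds:
  fixes G :: "complex mat"
  assumes G: "G \<in> carrier_mat N K" and k: "k < K"
    and diag: "\<And>j. j < K \<Longrightarrow> c \<le> (\<Sum>a<N. (cmod (G $$ (a, j)))\<^sup>2)"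
    and off: "\<And>m j. m < K \<Longrightarrow> j < K \<Longrightarrow> m \<noteq> j \<Longrightarrow> cmod (\<Sum>a<N. cnj (G $$ (a, m)) * G $$ (a, j)) \<le> d"
    and c: "c > 0" and d: "d \<ge> 0" "real K * d \<le> c / 2"
  defines "g \<equiv> row (zf_pinv G) k"
  shows "(vec_norm2 g)\<^sup>2 \<le> 2 / c"
    and "(vec_norm2 (transpose_mat (G * mat_diag K D) *\<^sub>v g))\<^sup>2 = (cmod (D k))\<^sup>2"
    and "B \<in> carrier_mat N K \<Longrightarrow> (vec_norm2 (transpose_mat B *\<^sub>v g))\<^sup>2
      \<le> (\<Sum>j<K. (\<Sum>m<K. 2 / c * cmod (\<Sum>a<N. cnj (G $$ (a, m)) * B $$ (a, j)))\<^sup>2)"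
proof -
  obtain h where h: "\<And>j. j < K \<Longrightarrow> cmod (h j) \<le> 2 / c"
    and g: "g = vec N (\<lambda>a. \<Sum>m<K. h m * cnj (G $$ (a, m)))"
    and hG: "\<And>j. j < K \<Longrightarrow> (\<Sum>m<K. h m * (\<Sum>a<N. cnj (G $$ (a, m)) * G $$ (a, j))) = (if j = k then 1 else 0)"
    unfolding g_def by (rule zf_pinv_row[OF G k diag off c d]) blast+
  have gG: "(transpose_mat G *\<^sub>v g) $ j = (if j = k then 1 else 0)" if "j < K" for j
    unfolding g using hG[OF that] transpose_mult_zf_row[OF G that, of h G K] by simp
  have gG': "(\<Sum>a<N. G $$ (a, j) * g $ a) = (if j = k then 1 else 0)" if "j < K" for j
    using gG[OF that] G that by (simp add: g scalar_prod_def lessThan_atLeast0)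
  \<comment> \<open>Only the conjugated factor is expanded through h; the other stays intact, so
    that g G = e_k collapses the sum over \<open>m\<close> to one term.\<close>
  have "complex_of_real ((vec_norm2 g)\<^sup>2) = (\<Sum>a<N. g $ a * cnj (g $ a))"
    by (simp add: vec_norm2_squared complex_norm_square g del: of_real_power)
  also have "\<dots> = (\<Sum>a<N. \<Sum>m<K. cnj (h m) * (G $$ (a, m) * g $ a))"
    by (simp add: g sum_distrib_left mult_ac)
  also have "\<dots> = (\<Sum>m<K. cnj (h m) * (\<Sum>a<N. G $$ (a, m) * g $ a))"
    by (subst sum.swap) (simp add: sum_distrib_left)
  also have "\<dots> = cnj (h k)"
  proof -
    have "(\<Sum>m<K. cnj (h m) * (\<Sum>a<N. G $$ (a, m) * g $ a)) = (\<Sum>m<K. if m = k then cnj (h m) else 0)"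
      by (intro sum.cong refl) (auto simp: gG')
    then show ?thesis using k by simp
  qed
  finally have "Re (complex_of_real ((vec_norm2 g)\<^sup>2)) = Re (cnj (h k))"
    by (rule arg_cong)
  then have "(vec_norm2 g)\<^sup>2 = Re (h k)"
    by (simp only: Re_complex_of_real cnj.simps)
  also have "\<dots> \<le> 2 / c"
    using h[OF k] complex_Re_le_cmod[of "h k"] by linarith
  finally show "(vec_norm2 g)\<^sup>2 \<le> 2 / c" .
  have D: "(transpose_mat (G * mat_diag K D) *\<^sub>v g) $ j = (if j = k then D k else 0)" if "j < K" for j
  proof -
    have "(transpose_mat (G * mat_diag K D) *\<^sub>v g) $ j = D j * (\<Sum>a<N. G $$ (a, j) * g $ a)"
      using G that by (simp add: g scalar_prod_def lessThan_atLeast0 mat_diag_mult_right sum_distrib_left mult_ac)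
    then show ?thesis by (simp add: gG'[OF that])
  qed
  have dim: "dim_vec (transpose_mat (G * mat_diag K D) *\<^sub>v g) = K"
    by (simp add: mat_diag_def)
  show "(vec_norm2 (transpose_mat (G * mat_diag K D) *\<^sub>v g))\<^sup>2 = (cmod (D k))\<^sup>2"
  proof -
    have "(\<Sum>j<K. (cmod ((transpose_mat (G * mat_diag K D) *\<^sub>v g) $ j))\<^sup>2) = (\<Sum>j<K. if j = k then (cmod (D j))\<^sup>2 else 0)"
      by (intro sum.cong refl) (auto simp: D)
    then show ?thesis
      unfolding vec_norm2_squared dim using k by simp
  qed
  show "(vec_norm2 (transpose_mat B *\<^sub>v g))\<^sup>2
      \<le> (\<Sum>j<K. (\<Sum>m<K. 2 / c * cmod (\<Sum>a<N. cnj (G $$ (a, m)) * B $$ (a, j)))\<^sup>2)"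
    if B: "B \<in> carrier_mat N K"
  proof -
    have "cmod ((transpose_mat B *\<^sub>v g) $ j) \<le> (\<Sum>m<K. 2 / c * cmod (\<Sum>a<N. cnj (G $$ (a, m)) * B $$ (a, j)))"
      if "j < K" for j
      unfolding g transpose_mult_zf_row[OF B that]
      by (intro sum_norm_le, unfold norm_mult, intro mult_right_mono h) auto
    moreover have "dim_vec (transpose_mat B *\<^sub>v g) = K" using B by simp
    ultimately show ?thesis
      unfolding vec_norm2_squared by (auto intro!: sum_mono power_mono)
  qed
qed

text \<open>This is the deterministic part, applied to one fixed outcome: every probabilistic input
  is reduced to eventual bounds and limits of numerical sequences.\<close>

lemma zf_sinr_tendsto:
  fixes G E :: "nat \<Rightarrow> nat \<Rightarrow> complex mat" and D :: "nat \<Rightarrow> nat \<Rightarrow> complex"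
  assumes k: "k < K" and p: "p > 0" and \<alpha>: "\<alpha> \<noteq> 0" and c: "c > 0"
    and G: "\<And>N. N \<ge> K \<Longrightarrow> G N l \<in> carrier_mat N K"
    and GD: "\<And>N i. N \<ge> K \<Longrightarrow> i < L \<Longrightarrow> i \<noteq> l \<Longrightarrow> G N i = G N l * mat_diag K (D i)"
    and E: "\<And>N i. N \<ge> K \<Longrightarrow> i < L \<Longrightarrow> E N i \<in> carrier_mat N K"
    and diag: "\<And>j. j < K \<Longrightarrow> eventually (\<lambda>N. (\<Sum>a<N. (cmod (G N l $$ (a, j)))\<^sup>2) > real N * c) sequentially"
    and off: "\<And>m j. m < K \<Longrightarrow> j < K \<Longrightarrow> m \<noteq> j \<Longrightarrow>
       (\<lambda>N. (\<Sum>a<N. cnj (G N l $$ (a, m)) * G N l $$ (a, j)) / of_nat N) \<longlonglongrightarrow> 0"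
    and cross: "\<And>i m j. i < L \<Longrightarrow> m < K \<Longrightarrow> j < K \<Longrightarrow>
       (\<lambda>N. (\<Sum>a<N. cnj (G N l $$ (a, m)) * E N i $$ (a, j)) / of_nat N) \<longlonglongrightarrow> 0"
    and C: "C = (\<Sum>i\<in>{..<L} - {l}. (cmod (D i k))\<^sup>2)" "C \<noteq> 0"
  shows "(\<lambda>N. zf_sinr \<alpha> p L l k (G N) (E N)) \<longlonglongrightarrow> 1 / C"
proof -
  let ?g = "\<lambda>N. row (zf_pinv (G N l)) k"
  let ?off = "\<lambda>N m j. \<Sum>a<N. cnj (G N l $$ (a, m)) * G N l $$ (a, j)"
  let ?cross = "\<lambda>N i m j. \<Sum>a<N. cnj (G N l $$ (a, m)) * E N i $$ (a, j)"
  \<comment> \<open>Chosen so that \<open>K * d = c / 2\<close>, the margin required for diagonal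
    dominance; both sides are later scaled by N.\<close>
  define d where "d = c / (2 * real K)"
  have d: "d > 0" "real K * d \<le> c / 2" using c k by (auto simp: d_def)
  have off_small: "eventually (\<lambda>N. cmod (?off N m j) \<le> real N * d) sequentially"
    if "m < K" "j < K" "m \<noteq> j" for m j
  proof -
    have "eventually (\<lambda>N. dist (?off N m j / of_nat N) 0 < d) sequentially"
      using off[OF that] d(1) by (rule tendstoD)
    then show ?thesis
      using eventually_gt_at_top[of 0]
      by eventually_elim (simp add: norm_divide field_simps)
  qed
  have "eventually (\<lambda>N. \<forall>j\<in>{..<K}. (\<Sum>a<N. (cmod (G N l $$ (a, j)))\<^sup>2) > real N * c) sequentially"
    using diag by (intro eventually_ball_finite) auto
  moreover have "eventually (\<lambda>N. \<forall>m\<in>{..<K}. \<forall>j\<in>{..<K}. m \<noteq> j \<longrightarrow> cmod (?off N m j) \<le> real N * d) sequentially"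
    using off_small by (intro eventually_ball_finite ballI) (auto simp: eventually_conj_iff)
  ultimately have good: "eventually (\<lambda>N. N \<ge> K \<and> (vec_norm2 (?g N))\<^sup>2 \<le> 2 / (real N * c)
      \<and> (\<forall>D. (vec_norm2 (transpose_mat (G N l * mat_diag K D) *\<^sub>v ?g N))\<^sup>2 = (cmod (D k))\<^sup>2)
      \<and> (\<forall>i<L. (vec_norm2 (transpose_mat (E N i) *\<^sub>v ?g N))\<^sup>2
           \<le> (\<Sum>j<K. (\<Sum>m<K. 2 / (real N * c) * cmod (?cross N i m j))\<^sup>2))) sequentially"
    using eventually_ge_at_top[of K]
  proof eventually_elim
    case (elim N)
    have N: "real N > 0" using elim(3) k by simp
    have *: "real N * c > 0" "real N * d \<ge> 0" "real K * (real N * d) \<le> real N * c / 2"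
      using N c d mult_left_mono[OF d(2), of "real N"] by (auto simp: mult_ac)
    have 1: "\<And>j. j < K \<Longrightarrow> real N * c \<le> (\<Sum>a<N. (cmod (G N l $$ (a, j)))\<^sup>2)"
      using elim(1) by (auto intro: less_imp_le)
    have 2: "\<And>m j. m < K \<Longrightarrow> j < K \<Longrightarrow> m \<noteq> j \<Longrightarrow> cmod (?off N m j) \<le> real N * d"
      using elim(2) by auto
    have "(vec_norm2 (?g N))\<^sup>2 \<le> 2 / (real N * c)"
      by (rule zf_pinv_row_bounds(1)[OF G[OF elim(3)] k 1 2 *])
    moreover have "(vec_norm2 (transpose_mat (G N l * mat_diag K D) *\<^sub>v ?g N))\<^sup>2 = (cmod (D k))\<^sup>2" for D
      by (rule zf_pinv_row_bounds(2)[OF G[OF elim(3)] k 1 2 *])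
    moreover have "(vec_norm2 (transpose_mat (E N i) *\<^sub>v ?g N))\<^sup>2
           \<le> (\<Sum>j<K. (\<Sum>m<K. 2 / (real N * c) * cmod (?cross N i m j))\<^sup>2)" if "i < L" for i
      by (rule zf_pinv_row_bounds(3)[OF G[OF elim(3)] k 1 2 * E[OF elim(3) that]])
    ultimately show ?case
      using elim(3) by blast
  qed
  have g0: "(\<lambda>N. (vec_norm2 (?g N))\<^sup>2) \<longlonglongrightarrow> 0"
  proof (rule Lim_null_comparison)
    show "eventually (\<lambda>N. norm ((vec_norm2 (?g N))\<^sup>2) \<le> 2 / c * (1 / real N)) sequentially"
      using good by eventually_elim (simp add: mult.commute)
    show "(\<lambda>N. 2 / c * (1 / real N)) \<longlonglongrightarrow> 0"
      by (intro tendsto_mult_right_zero lim_1_over_n)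
  qed
  have E0: "(\<lambda>N. (vec_norm2 (transpose_mat (E N i) *\<^sub>v ?g N))\<^sup>2) \<longlonglongrightarrow> 0" if i: "i < L" for i
  proof (rule Lim_null_comparison)
    show "eventually (\<lambda>N. norm ((vec_norm2 (transpose_mat (E N i) *\<^sub>v ?g N))\<^sup>2)
        \<le> (\<Sum>j<K. (\<Sum>m<K. 2 / c * cmod (?cross N i m j / of_nat N))\<^sup>2)) sequentially"
      using good
    proof eventually_elim
      case (elim N)
      \<comment> \<open>The factor 1/N supplied by the bound on h is moved to the inner product,
        turning it into the average assumed to tend to 0.\<close>
      have "2 / (real N * c) * x = 2 / c * (x / real N)" for x by simp
      then have "(\<Sum>j<K. (\<Sum>m<K. 2 / (real N * c) * cmod (?cross N i m j))\<^sup>2)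
          = (\<Sum>j<K. (\<Sum>m<K. 2 / c * cmod (?cross N i m j / of_nat N))\<^sup>2)"
        by (simp only: norm_divide norm_of_nat)
      moreover have "(vec_norm2 (transpose_mat (E N i) *\<^sub>v ?g N))\<^sup>2
          \<le> (\<Sum>j<K. (\<Sum>m<K. 2 / (real N * c) * cmod (?cross N i m j))\<^sup>2)"
        using elim i by blast
      ultimately show ?case
        by (simp only: real_norm_def abs_power2 power2_abs abs_of_nonneg zero_le_power2)
    qed
    have "(\<lambda>N. \<Sum>j<K. (\<Sum>m<K. 2 / c * cmod (?cross N i m j / of_nat N))\<^sup>2)
        \<longlonglongrightarrow> (\<Sum>j<K. (\<Sum>m<K. 2 / c * cmod 0)\<^sup>2)"
      using cross[OF i] by (intro tendsto_intros) auto
    then show "(\<lambda>N. \<Sum>j<K. (\<Sum>m<K. 2 / c * cmod (?cross N i m j / of_nat N))\<^sup>2) \<longlonglongrightarrow> 0"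
      by simp
  qed
  \<comment> \<open>The contamination sum is replaced by its exact value \<open>C\<close>; the
    resulting expression agrees with the SINR for all large N, and its denominator has the nonzero
    limit \<open>\<alpha>^2 * p * C\<close>.\<close>
  have "(\<lambda>N. \<alpha>\<^sup>2 * p / (\<alpha>\<^sup>2 * p * C + p * (\<Sum>i<L. (vec_norm2 (transpose_mat (E N i) *\<^sub>v ?g N))\<^sup>2) + (vec_norm2 (?g N))\<^sup>2))
      \<longlonglongrightarrow> \<alpha>\<^sup>2 * p / (\<alpha>\<^sup>2 * p * C + p * (\<Sum>i<L. 0) + 0)"
    using E0 g0 \<alpha> p C(2) by (intro tendsto_intros) auto
  moreover have "\<alpha>\<^sup>2 * p / (\<alpha>\<^sup>2 * p * C + p * (\<Sum>i<L. 0) + 0) = 1 / C"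
    using \<alpha> p by simp
  moreover have "eventually (\<lambda>N. \<alpha>\<^sup>2 * p / (\<alpha>\<^sup>2 * p * C + p * (\<Sum>i<L. (vec_norm2 (transpose_mat (E N i) *\<^sub>v ?g N))\<^sup>2) + (vec_norm2 (?g N))\<^sup>2)
      = zf_sinr \<alpha> p L l k (G N) (E N)) sequentially"
    using good
  proof eventually_elim
    case (elim N)
    have "(\<Sum>i\<in>{..<L} - {l}. (vec_norm2 (transpose_mat (G N i) *\<^sub>v ?g N))\<^sup>2) = C"
      unfolding C(1) using elim GD by (intro sum.cong) auto
    then show ?case by (simp add: zf_sinr_def Let_def)
  qed
  ultimately show ?thesis
    by (simp only: tendsto_cong)
qed

section \<open>The channel model\<close>

lemma beta_hat_pos:
  assumes "p_tr > 0" "i < L" and \<beta>: "\<And>i. i < L \<Longrightarrow> \<beta> l i j > 0"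
  shows "beta_hat \<beta> L p_tr l i j > 0"
proof -
  have "(\<Sum>i'<L. \<beta> l i' j) \<ge> 0"
    using \<beta> by (intro sum_nonneg) (auto intro: less_imp_le)
  moreover have "\<beta> l i j > 0" "1 / p_tr > 0" using assms by auto
  ultimately show ?thesis unfolding beta_hat_def by (intro divide_pos_pos add_nonneg_pos) auto
qed

text \<open>The denominator exceeds \<beta> by at least the pilot noise term
  \<open>1 / p_tr\<close>; this keeps the inequality strict.\<close>

lemma beta_hat_less:
  assumes "p_tr > 0" "i < L" and \<beta>: "\<And>i. i < L \<Longrightarrow> \<beta> l i j > 0"
  shows "beta_hat \<beta> L p_tr l i j < \<beta> l i j"
proof -
  have pos: "\<beta> l i j > 0" "1 / p_tr > 0" using assms by auto
  have "\<beta> l i j \<le> (\<Sum>i'<L. \<beta> l i' j)"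
    using \<beta> assms(2) by (intro member_le_sum) (auto intro: less_imp_le)
  then have "\<beta> l i j < (\<Sum>i'<L. \<beta> l i' j) + 1 / p_tr" using pos by linarith
  then show ?thesis
    unfolding beta_hat_def using pos by (subst pos_divide_less_eq) (auto simp: power2_eq_square)
qed

text \<open>Strictness of the previous bound covers the case of |\<alpha>| equal to 1. Positive
  variance is what the exponential moment formulas assume.\<close>

lemma error_variance_pos:
  assumes "p_tr > 0" "i < L" and \<beta>: "\<And>i. i < L \<Longrightarrow> \<beta> l i j > 0"
    and "\<bar>\<alpha>\<bar> \<le> 1"
  shows "\<beta> l i j - \<alpha>\<^sup>2 * beta_hat \<beta> L p_tr l i j > 0"
proof -
  have "\<alpha>\<^sup>2 \<le> 1" using \<open>\<bar>\<alpha>\<bar> \<le> 1\<close> by (simp add: abs_square_le_1)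
  then have "\<alpha>\<^sup>2 * beta_hat \<beta> L p_tr l i j \<le> 1 * beta_hat \<beta> L p_tr l i j"
    using beta_hat_pos[of p_tr i L \<beta> l j, OF assms(1-3)] by (intro mult_right_mono) auto
  with beta_hat_less[of p_tr i L \<beta> l j, OF assms(1-3)] show ?thesis by simp
qed

context prob_space
begin

lemma indep_var_of_indep_vars:
  assumes "indep_vars M' X I" "i \<in> I" "j \<in> I" "i \<noteq> j"
  shows "indep_var (M' i) (X i) (M' j) (X j)"
proof -
  have "indep_var (PiM {i} M') (\<lambda>\<omega>. restrict (\<lambda>i. X i \<omega>) {i}) (PiM {j} M') (\<lambda>\<omega>. restrict (\<lambda>i. X i \<omega>) {j})"
    using assms by (intro indep_var_restrict) auto
  from indep_var_compose[OF this measurable_component_singleton measurable_component_singleton, of i j]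
  show ?thesis by (simp add: comp_def)
qed

lemma gaussian_columnsD:
  assumes "gaussian_columns M N K v X"
  shows "\<omega> \<in> space M \<Longrightarrow> X \<omega> \<in> carrier_mat N K"
    and "j < K \<Longrightarrow> distr M (\<Pi>\<^sub>M a\<in>{..<N}. borel) (\<lambda>\<omega>. \<lambda>a\<in>{..<N}. X \<omega> $$ (a, j))
              = complex_gaussian (complex_of_real (v j) \<cdot>\<^sub>m 1\<^sub>m N)"
    and "j < K \<Longrightarrow> random_variable (\<Pi>\<^sub>M a\<in>{..<N}. borel) (\<lambda>\<omega>. \<lambda>a\<in>{..<N}. X \<omega> $$ (a, j))"
    and "m < K \<Longrightarrow> j < K \<Longrightarrow> m \<noteq> j \<Longrightarrow>
      indep_var (\<Pi>\<^sub>M a\<in>{..<N}. borel) (\<lambda>\<omega>. \<lambda>a\<in>{..<N}. X \<omega> $$ (a, m))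
                (\<Pi>\<^sub>M a\<in>{..<N}. borel) (\<lambda>\<omega>. \<lambda>a\<in>{..<N}. X \<omega> $$ (a, j))"
proof -
  have ind: "indep_vars (\<lambda>j. \<Pi>\<^sub>M a\<in>{..<N}. borel) (\<lambda>j \<omega>. \<lambda>a\<in>{..<N}. X \<omega> $$ (a, j)) {..<K}"
    using assms unfolding gaussian_columns_def by blast
  show "random_variable (\<Pi>\<^sub>M a\<in>{..<N}. borel) (\<lambda>\<omega>. \<lambda>a\<in>{..<N}. X \<omega> $$ (a, j))" if "j < K"
    using ind that unfolding indep_vars_def by auto
  show "indep_var (\<Pi>\<^sub>M a\<in>{..<N}. borel) (\<lambda>\<omega>. \<lambda>a\<in>{..<N}. X \<omega> $$ (a, m))
                (\<Pi>\<^sub>M a\<in>{..<N}. borel) (\<lambda>\<omega>. \<lambda>a\<in>{..<N}. X \<omega> $$ (a, j))"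
    if "m < K" "j < K" "m \<noteq> j"
    using indep_var_of_indep_vars[OF ind, of m j] that by simp
qed (use assms in \<open>auto simp: gaussian_columns_def\<close>)

text \<open>A column is a coordinate projection of the whole array, so independence of the arrays
  passes to it.\<close>

lemma indep_var_columns:
  fixes E G :: "nat \<Rightarrow> 'a \<Rightarrow> complex mat"
  assumes ind: "indep_var
      (\<Pi>\<^sub>M _\<in>I \<times> {..<N} \<times> {..<K}. borel) (\<lambda>\<omega>. \<lambda>(i, a, j)\<in>I \<times> {..<N} \<times> {..<K}. E i \<omega> $$ (a, j))
      (\<Pi>\<^sub>M _\<in>I' \<times> {..<N} \<times> {..<K}. borel) (\<lambda>\<omega>. \<lambda>(i, a, j)\<in>I' \<times> {..<N} \<times> {..<K}. G i \<omega> $$ (a, j))"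
    and i: "i \<in> I" "i' \<in> I'" "m < K" "j < K"
  shows "indep_var (\<Pi>\<^sub>M a\<in>{..<N}. borel) (\<lambda>\<omega>. \<lambda>a\<in>{..<N}. E i \<omega> $$ (a, m))
                   (\<Pi>\<^sub>M a\<in>{..<N}. borel) (\<lambda>\<omega>. \<lambda>a\<in>{..<N}. G i' \<omega> $$ (a, j))"
proof -
  have proj: "(\<lambda>x. \<lambda>a\<in>{..<N}. x (i, a, j)) \<in> measurable (\<Pi>\<^sub>M _\<in>J \<times> {..<N} \<times> {..<K}. borel) (\<Pi>\<^sub>M a\<in>{..<N}. borel :: complex measure)"
    if "i \<in> J" "j < K" for i :: nat and J j
    using that by (intro measurable_restrict measurable_component_singleton) auto
  from indep_var_compose[OF ind proj[of i I m] proj[of i' I' j]] i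
  show ?thesis by (simp add: comp_def cong: restrict_cong)
qed

end

theorem mainTheorem6:
  fixes M :: "'a measure"
    and L K \<tau> l k :: nat
    and p_r \<alpha> C :: real
    and \<beta> :: "nat \<Rightarrow> nat \<Rightarrow> nat \<Rightarrow> real"
    and G E :: "nat \<Rightarrow> nat \<Rightarrow> 'a \<Rightarrow> complex mat"
  assumes "prob_space M"
    and "L \<ge> 2" and "K \<ge> 1" and "\<tau> \<ge> K" and "l < L" and "k < K"
    and "p_r > 0" and "0 < \<bar>\<alpha>\<bar>" and "\<bar>\<alpha>\<bar> \<le> 1"
    and "\<And>i j. i < L \<Longrightarrow> j < K \<Longrightarrow> \<beta> l i j > 0"
    and "C = (\<Sum>i\<in>{..<L} - {l}. (\<beta> l i k / \<beta> l l k)\<^sup>2)"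
    and "\<And>N. N \<ge> K \<Longrightarrow>
           gaussian_columns M N K (\<lambda>j. beta_hat \<beta> L (real \<tau> * p_r) l l j) (G N l)"
    and "\<And>N i \<omega>. N \<ge> K \<Longrightarrow> i < L \<Longrightarrow> i \<noteq> l \<Longrightarrow> \<omega> \<in> space M \<Longrightarrow>
           G N i \<omega> = G N l \<omega> * mat_diag K (\<lambda>j. complex_of_real (\<beta> l i j / \<beta> l l j))"
    and "\<And>N i. N \<ge> K \<Longrightarrow> i < L \<Longrightarrow>
           gaussian_columns M N K
             (\<lambda>j. \<beta> l i j - \<alpha>\<^sup>2 * beta_hat \<beta> L (real \<tau> * p_r) l i j) (E N i)"
    and "\<And>N. N \<ge> K \<Longrightarrow>
           prob_space.indep_var M
             (\<Pi>\<^sub>M _\<in>{..<L} \<times> {..<N} \<times> {..<K}. borel)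
             (\<lambda>\<omega>. \<lambda>(i, a, j)\<in>{..<L} \<times> {..<N} \<times> {..<K}. E N i \<omega> $$ (a, j))
             (\<Pi>\<^sub>M _\<in>{l} \<times> {..<N} \<times> {..<K}. borel)
             (\<lambda>\<omega>. \<lambda>(i, a, j)\<in>{l} \<times> {..<N} \<times> {..<K}. G N i \<omega> $$ (a, j))"
  shows "AE \<omega> in M.
           (\<lambda>N. zf_sinr \<alpha> p_r L l k (\<lambda>i. G N i \<omega>) (\<lambda>i. E N i \<omega>)) \<longlonglongrightarrow> 1 / C"
proof -
  interpret prob_space M by fact
  note \<beta>_pos = assms(10) and G = assms(12) and GD = assms(13) and E = assms(14) and EG = assms(15)
  have p_tr: "real \<tau> * p_r > 0" using assms(3,4,7) by simp
  let ?v = "\<lambda>j. beta_hat \<beta> L (real \<tau> * p_r) l l j"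
  let ?w = "\<lambda>i j. \<beta> l i j - \<alpha>\<^sup>2 * beta_hat \<beta> L (real \<tau> * p_r) l i j"
  have v: "?v j > 0" if "j < K" for j
    using that by (intro beta_hat_pos p_tr \<open>l < L\<close> \<beta>_pos)
  have w: "?w i j > 0" if "i < L" "j < K" for i j
    using that by (intro error_variance_pos p_tr \<beta>_pos \<open>\<bar>\<alpha>\<bar> \<le> 1\<close>)
  \<comment> \<open>One positive lower bound serving all K columns at once.\<close>
  define c where "c = Min (?v ` {..<K}) / 2"
  have "Min (?v ` {..<K}) \<in> ?v ` {..<K}"
    using \<open>k < K\<close> by (intro Min_in) auto
  then have c: "c > 0" using v by (auto simp: c_def)
  have c_le: "c \<le> ?v j / 2" if "j < K" for j
    using that by (auto simp: c_def intro!: Min_le)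
  \<comment> \<open>A second cell makes the sum defining \<open>C\<close> nonempty, hence
    positive.\<close>
  have "\<exists>i. i \<in> {..<L} - {l}"
    using \<open>L \<ge> 2\<close> by (intro exI[of _ "if l = 0 then 1 else 0"]) auto
  then have C_pos: "C > 0"
    unfolding assms(11) using \<open>l < L\<close> \<open>k < K\<close>
    by (intro sum_pos zero_less_power divide_pos_pos \<beta>_pos) auto

  have diag: "AE \<omega> in M. \<forall>j\<in>{..<K}. eventually (\<lambda>N. (\<Sum>a<N. (cmod (G N l \<omega> $$ (a, j)))\<^sup>2) > real N * (?v j / 2)) sequentially"
  proof (subst AE_ball_countable, simp, intro ballI)
    fix j assume "j \<in> {..<K}"
    then have j: "j < K" by simp
    show "AE \<omega> in M. eventually (\<lambda>N. (\<Sum>a<N. (cmod (G N l \<omega> $$ (a, j)))\<^sup>2) > real N * (?v j / 2)) sequentially"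
      using AE_eventually_gaussian_norm_gt[OF v[OF j], where k = K and X = "\<lambda>N \<omega>. \<lambda>a\<in>{..<N}. G N l \<omega> $$ (a, j)",
          OF gaussian_columnsD(3)[OF G j] gaussian_columnsD(2)[OF G j]]
      by simp
  qed
  have off: "AE \<omega> in M. \<forall>m\<in>{..<K}. \<forall>j\<in>{..<K} - {m}.
      (\<lambda>N. (\<Sum>a<N. cnj (G N l \<omega> $$ (a, m)) * G N l \<omega> $$ (a, j)) / of_nat N) \<longlonglongrightarrow> 0"
  proof (subst AE_ball_countable, simp, intro ballI, subst AE_ball_countable, simp, intro ballI)
    fix m j assume "m \<in> {..<K}" "j \<in> {..<K} - {m}"
    then have mj: "m < K" "j < K" "m \<noteq> j" by auto
    show "AE \<omega> in M. (\<lambda>N. (\<Sum>a<N. cnj (G N l \<omega> $$ (a, m)) * G N l \<omega> $$ (a, j)) / of_nat N) \<longlonglongrightarrow> 0"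
      using AE_gaussian_inner_mean_tendsto_0[OF v[OF mj(1)] v[OF mj(2)], where k = K
          and X = "\<lambda>N \<omega>. \<lambda>a\<in>{..<N}. G N l \<omega> $$ (a, m)" and Y = "\<lambda>N \<omega>. \<lambda>a\<in>{..<N}. G N l \<omega> $$ (a, j)",
          OF gaussian_columnsD(4)[OF G mj] gaussian_columnsD(2)[OF G mj(1)] gaussian_columnsD(2)[OF G mj(2)]]
      by simp
  qed
  \<comment> \<open>The error column carries the conjugate because the independence assumption lists
    errors before channels; conjugating the limit later restores the order G^H E.\<close>
  have cross: "AE \<omega> in M. \<forall>i\<in>{..<L}. \<forall>m\<in>{..<K}. \<forall>j\<in>{..<K}.
      (\<lambda>N. (\<Sum>a<N. cnj (E N i \<omega> $$ (a, j)) * G N l \<omega> $$ (a, m)) / of_nat N) \<longlonglongrightarrow> 0"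
  proof (subst AE_ball_countable, simp, intro ballI, subst AE_ball_countable, simp, intro ballI,
      subst AE_ball_countable, simp, intro ballI)
    fix i m j assume "i \<in> {..<L}" "m \<in> {..<K}" "j \<in> {..<K}"
    then have i: "i < L" and m: "m < K" and j: "j < K" by auto
    have ind: "indep_var (\<Pi>\<^sub>M a\<in>{..<N}. borel) (\<lambda>\<omega>. \<lambda>a\<in>{..<N}. E N i \<omega> $$ (a, j))
                   (\<Pi>\<^sub>M a\<in>{..<N}. borel) (\<lambda>\<omega>. \<lambda>a\<in>{..<N}. G N l \<omega> $$ (a, m))" if "N \<ge> K" for N
      using i m j by (intro indep_var_columns[OF EG[OF that]]) auto
    show "AE \<omega> in M. (\<lambda>N. (\<Sum>a<N. cnj (E N i \<omega> $$ (a, j)) * G N l \<omega> $$ (a, m)) / of_nat N) \<longlonglongrightarrow> 0"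
      using AE_gaussian_inner_mean_tendsto_0[OF w[OF i j] v[OF m], where k = K
          and X = "\<lambda>N \<omega>. \<lambda>a\<in>{..<N}. E N i \<omega> $$ (a, j)" and Y = "\<lambda>N \<omega>. \<lambda>a\<in>{..<N}. G N l \<omega> $$ (a, m)",
          OF ind gaussian_columnsD(2)[OF E[OF _ i] j] gaussian_columnsD(2)[OF G m]]
      by simp
  qed

  \<comment> \<open>The almost sure events are intersected and the outcome is fixed.
    \<open>AE_space\<close> joins them since the matrix dimensions and the relation between the
    channels are assumed only on the sample space.\<close>
  show ?thesis
    using diag off cross AE_space
  proof eventually_elim
    case (elim \<omega>)
    show ?case
    proof (rule zf_sinr_tendsto[where K = K and c = c and D = "\<lambda>i j. complex_of_real (\<beta> l i j / \<beta> l l j)"])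
      show "eventually (\<lambda>N. (\<Sum>a<N. (cmod (G N l \<omega> $$ (a, j)))\<^sup>2) > real N * c) sequentially" if j: "j < K" for j
      proof -
        have "eventually (\<lambda>N. (\<Sum>a<N. (cmod (G N l \<omega> $$ (a, j)))\<^sup>2) > real N * (?v j / 2)) sequentially"
          using elim(1) j by blast
        then show ?thesis
        proof eventually_elim
          case (elim N)
          have "real N * c \<le> real N * (?v j / 2)"
            using c_le[OF j] by (intro mult_left_mono) auto
          with elim show ?case by linarith
        qed
      qed
      show "(\<lambda>N. (\<Sum>a<N. cnj (G N l \<omega> $$ (a, m)) * E N i \<omega> $$ (a, j)) / of_nat N) \<longlonglongrightarrow> 0"
        if "i < L" "m < K" "j < K" for i m j
      proof -
        have "(\<lambda>N. (\<Sum>a<N. cnj (E N i \<omega> $$ (a, j)) * G N l \<omega> $$ (a, m)) / of_nat N) \<longlonglongrightarrow> 0"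
          using elim(3) that by blast
        from tendsto_cnj[OF this] show ?thesis
          by (simp add: mult.commute)
      qed
      show "C = (\<Sum>i\<in>{..<L} - {l}. (cmod (complex_of_real (\<beta> l i k / \<beta> l l k)))\<^sup>2)"
        by (simp only: assms(11) norm_of_real power2_abs)
      show "(\<lambda>N. (\<Sum>a<N. cnj (G N l \<omega> $$ (a, m)) * G N l \<omega> $$ (a, j)) / of_nat N) \<longlonglongrightarrow> 0"
        if "m < K" "j < K" "m \<noteq> j" for m j
        using elim(2) that by blast
      show "G N l \<omega> \<in> carrier_mat N K" if "N \<ge> K" for N
        using gaussian_columnsD(1)[OF G[OF that]] elim(4) .
      show "E N i \<omega> \<in> carrier_mat N K" if "N \<ge> K" "i < L" for N i
        using gaussian_columnsD(1)[OF E[OF that]] elim(4) .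
      show "G N i \<omega> = G N l \<omega> * mat_diag K (\<lambda>j. complex_of_real (\<beta> l i j / \<beta> l l j))"
        if "N \<ge> K" "i < L" "i \<noteq> l" for N i
        using GD that elim(4) by blast
    qed (use assms c C_pos in auto)
  qed
qed

end
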